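(* Let $k\ge 2$ be an integer and let $n\ge 2k$ be an integer. Then the adjacency spectrum of the line graph $L(BL_n(k-1,k))$ consists of exactly the following eigenvalues with the following multiplicities: \begin{itemize} \item $-2$, with multiplicity $k\binom{n}{k}-\binom{n+1}{k}+1$; \item $j-2$, for each $j=1,2,\ldots,k-1$, with multiplicity $\binom{n}{j}-\binom{n}{j-1}$; \item $n-1-j$, for each $j=0,1,\ldots,k-1$, with multiplicity $\binom{n}{j}-\binom{n}{j-1}$; \item $k-2$, with multiplicity $\binom{n}{k}-\binom{n}{k-1}$. \end{itemize}
   Context: Let $[n]=\{1,\ldots,n\}$. For $n\ge 3$, the Boolean lattice $BL_n$ is the graph whose vertices are all subsets of $[n]$, two subsets being adjacent if and only if their symmetric difference has exactly one element. $BL_n(k-1,k)$ is the induced subgraph of $BL_n$ on the set of all $(k-1)$-element subsets and all $k$-element subsets of $[n]$; that is, it is the bipartite graph in which a $(k-1)$-subset $U$ is adjacent to a $k$-subset $W$ if and only if $U\subset W$. The line graph $L(\Gamma)$ of a graph $\Gamma$ has as vertices the edges of $\Gamma$, two distinct edges being adjacent if and only if they share an endpoint. The spectrum of a graph is the multiset of eigenvalues of its adjacency matrix. Convention: $\binom{n}{-1}=0$. *)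

theory Defs
  imports
    "HOL-Library.Multiset"
    "HOL-Computational_Algebra.Polynomial"
    "Jordan_Normal_Form.Char_Poly"
    "Jordan_Normal_Form.Spectral_Radius"
begin

text \<open>A simple graph is a pair of a vertex set and a set of edges, each edge being a
  two-element set of vertices.\<close>

type_synonym 'a graph = "'a set \<times> 'a set set"

abbreviation verts :: "'a graph \<Rightarrow> 'a set" where "verts \<equiv> fst"
abbreviation edges :: "'a graph \<Rightarrow> 'a set set" where "edges \<equiv> snd"

definition induced_subgraph :: "'a graph \<Rightarrow> 'a set \<Rightarrow> 'a graph" where
  "induced_subgraph G S = (verts G \<inter> S, {e \<in> edges G. e \<subseteq> S})"

definition line_graph :: "'a graph \<Rightarrow> 'a set graph" where
  "line_graph G =
     (edges G, {{e, f} | e f. e \<in> edges G \<and> f \<in> edges G \<and> e \<noteq> f \<and> e \<inter> f \<noteq> {}})"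

definition BL :: "nat \<Rightarrow> nat set graph" where
  "BL n = (Pow {1..n},
           {{U, W} | U W. U \<subseteq> {1..n} \<and> W \<subseteq> {1..n} \<and> card (sym_diff U W) = 1})"

text \<open>\<open>BL_layers n k\<close> is $BL_n(k-1,k)$; it is meant for \<open>k \<ge> 1\<close>.\<close>

definition BL_layers :: "nat \<Rightarrow> nat \<Rightarrow> nat set graph" where
  "BL_layers n k = induced_subgraph (BL n) {U. card U = k - 1 \<or> card U = k}"

text \<open>The rows and columns of the adjacency matrix are indexed by the positions in a list
  enumerating the vertices without repetition. The entries are complex so that no
  eigenvalue is lost in the spectrum.\<close>

definition vertex_enum :: "'a graph \<Rightarrow> 'a list \<Rightarrow> bool" where
  "vertex_enum G vs \<longleftrightarrow> distinct vs \<and> set vs = verts G"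

definition adjacency_matrix :: "'a graph \<Rightarrow> 'a list \<Rightarrow> complex mat" where
  "adjacency_matrix G vs =
     mat (length vs) (length vs) (\<lambda>(i, j). if {vs ! i, vs ! j} \<in> edges G then 1 else 0)"

text \<open>The multiset of eigenvalues, each with its multiplicity as a root of the
  characteristic polynomial.\<close>

definition spectrum_mset :: "complex mat \<Rightarrow> complex multiset" where
  "spectrum_mset A = proots (char_poly A)"

lemma set_spectrum_mset:
  assumes "A \<in> carrier_mat m m"
  shows "set_mset (spectrum_mset A) = spectrum A"
proof -
  have "char_poly A \<noteq> 0"
    using degree_monic_char_poly[OF assms] by auto
  then show ?thesis
    by (auto simp: spectrum_mset_def spectrum_def eigenvalue_root_char_poly[OF assms])
qed

text \<open>Binomial coefficients with an integer lower index, so that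
  \<open>binom n (- 1) = 0\<close>.\<close>

definition binom :: "nat \<Rightarrow> int \<Rightarrow> nat" where
  "binom n j = (if j < 0 then 0 else n choose nat j)"

text \<open>In the range considered, the differences of binomial coefficients that occur as
  multiplicities are not truncated by subtraction on the natural numbers.\<close>

lemma binom_pred_le:
  assumes "2 * k \<le> n" "j \<le> k"
  shows "binom n (int j - 1) \<le> binom n (int j)"
proof (cases j)
  case 0
  then show ?thesis by (simp add: binom_def)
next
  case (Suc i)
  then have "n choose i \<le> n choose j"
    using assms by (intro binomial_mono) auto
  then show ?thesis using Suc by (simp add: binom_def nat_add_distrib)
qed

lemma choose_Suc_le_mult_choose:
  assumes "2 \<le> k" "2 * k \<le> n"
  shows "(n + 1) choose k \<le> k * (n choose k)"
proof -
  obtain i where i: "k = Suc i" using assms by (cases k) auto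
  have "n choose i \<le> n choose k"
    using assms i by (intro binomial_mono) auto
  then have "(n + 1) choose k \<le> 2 * (n choose k)" using i by simp
  also have "\<dots> \<le> k * (n choose k)" using assms by simp
  finally show ?thesis .
qed

end

theory Submission
  imports Defs
begin

text \<open>
  Let $B$ be the vertex-edge incidence matrix of a graph $G$. Then $B^T B = A(L(G)) + 2I$, while
  $B B^T$ is the signless Laplacian of $G$, and by Sylvester's determinant identity the
  characteristic polynomials of $B^T B$ and $B B^T$ differ only by a power of $x$. For
  $G = BL_n(k-1,k)$ the signless Laplacian is a block matrix with scalar diagonal blocks
  $(n-k+1) I$ and $k I$ and off-diagonal blocks $M$, $M^T$, where $M$ is the inclusion matrix between
  the two layers. A Schur complement reduces its characteristic polynomial to that of $M M^T$ at
  $(y-k)(y-(n-k+1))$.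

  If $W_i$ is the inclusion matrix between layers $i$ and $i+1$, then
  $W_i W_i^T = W_{i-1}^T W_{i-1} + (n-2i) I$. With Sylvester's identity this gives, by induction on
  $i$, the eigenvalues $(i+1-j)(n-i-j)$ of $W_i W_i^T$ with multiplicities
  $\binom{n}{j}-\binom{n}{j-1}$ for $0 \le j \le i$. For $i = k-1$ the factor with index $j$ becomes
  $(y-k)(y-(n-k+1)) - (k-j)(n-k+1-j) = (y-j)(y-(n+1-j))$.
\<close>

section \<open>Sylvester's determinant identity\<close>

text \<open>Characteristic polynomials are compared through their values, so that all determinants
  below are taken over the base field and not over a polynomial ring.\<close>

lemma poly_char_poly:
  fixes A :: "'a :: field mat"
  assumes "A \<in> carrier_mat n n"
  shows "poly (char_poly A) x = det (x \<cdot>\<^sub>m 1\<^sub>m n - A)"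
  unfolding char_poly_def
  by (rule poly_det_cong[of _ n]) (use assms in \<open>auto simp: char_poly_matrix_def\<close>)

lemma one_smult_mat [simp]:
  fixes A :: "'a :: monoid_mult mat"
  shows "1 \<cdot>\<^sub>m A = A"
  by (rule eq_matI) auto

text \<open>Right multiplication by the block triangular \<open>?N\<close> clears the lower left
  block. Scaling its first block column by d, at the cost of the factor d^p, replaces division by d,
  so the identity also covers d = 0.\<close>

lemma det_four_block_scalar_lower_right:
  fixes A :: "'a :: idom mat"
  assumes A: "A \<in> carrier_mat p p" and B: "B \<in> carrier_mat p q" and C: "C \<in> carrier_mat q p"
  shows "det (four_block_mat A B C (d \<cdot>\<^sub>m 1\<^sub>m q)) * d ^ p = det (d \<cdot>\<^sub>m A - B * C) * d ^ q"
proof -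
  let ?M = "four_block_mat A B C (d \<cdot>\<^sub>m 1\<^sub>m q)"
  let ?N = "four_block_mat (d \<cdot>\<^sub>m 1\<^sub>m p) (0\<^sub>m p q) (- C) (1\<^sub>m q)"
  have MN: "?M * ?N = four_block_mat (d \<cdot>\<^sub>m A - B * C) B (0\<^sub>m q p) (d \<cdot>\<^sub>m 1\<^sub>m q)"
    by (subst mult_four_block_mat[OF A B C, of _ _ p _ q])
       (use A B C in \<open>auto intro!: arg_cong2[where f = "\<lambda>X Y. four_block_mat X B Y (d \<cdot>\<^sub>m 1\<^sub>m q)"] eq_matI
          simp: mult_smult_distrib mult_smult_assoc_mat scalar_prod_uminus_right\<close>)
  have "det ?M * det ?N = det (?M * ?N)"
    by (rule det_mult[symmetric, of _ "p + q"]) (use A B C in auto)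
  also have "\<dots> = det (d \<cdot>\<^sub>m A - B * C) * d ^ q"
    unfolding MN by (subst det_four_block_mat_lower_left_zero[of _ p _ q]) (use A B C in auto)
  also have "det ?N = d ^ p"
    by (subst det_four_block_mat_upper_right_zero[of _ p _ q]) (use C in auto)
  finally show ?thesis .
qed

text \<open>The mirror image: \<open>?N\<close> clears the upper right block and scales the second
  block column by c.\<close>

lemma det_four_block_scalar_upper_left:
  fixes D :: "'a :: idom mat"
  assumes D: "D \<in> carrier_mat q q" and B: "B \<in> carrier_mat p q" and C: "C \<in> carrier_mat q p"
  shows "det (four_block_mat (c \<cdot>\<^sub>m 1\<^sub>m p) B C D) * c ^ q = c ^ p * det (c \<cdot>\<^sub>m D - C * B)"
proof -
  let ?M = "four_block_mat (c \<cdot>\<^sub>m 1\<^sub>m p) B C D"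
  let ?N = "four_block_mat (1\<^sub>m p) (- B) (0\<^sub>m q p) (c \<cdot>\<^sub>m 1\<^sub>m q)"
  have MN: "?M * ?N = four_block_mat (c \<cdot>\<^sub>m 1\<^sub>m p) (0\<^sub>m p q) C (c \<cdot>\<^sub>m D - C * B)"
    by (subst mult_four_block_mat[OF _ B C D, of _ _ p _ q])
       (use D B C in \<open>auto intro!: arg_cong2[where f = "\<lambda>X Y. four_block_mat (c \<cdot>\<^sub>m 1\<^sub>m p) X C Y"] eq_matI
          simp: mult_smult_distrib mult_smult_assoc_mat scalar_prod_uminus_right\<close>)
  have "det ?M * det ?N = det (?M * ?N)"
    by (rule det_mult[symmetric, of _ "p + q"]) (use D B C in auto)
  also have "\<dots> = c ^ p * det (c \<cdot>\<^sub>m D - C * B)"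
    unfolding MN by (subst det_four_block_mat_upper_right_zero[of _ p _ q]) (use D B C in auto)
  also have "det ?N = c ^ q"
    by (subst det_four_block_mat_lower_left_zero[of _ p _ q]) (use B in auto)
  finally show ?thesis .
qed

text \<open>The determinant of one block matrix, with rows (yI, A) and (B, I), is evaluated through
  each of its two scalar diagonal blocks.\<close>

lemma det_scalar_minus_mult_commute:
  fixes A B :: "'a :: idom mat"
  assumes A: "A \<in> carrier_mat p q" and B: "B \<in> carrier_mat q p"
  shows "y ^ q * det (y \<cdot>\<^sub>m 1\<^sub>m p - A * B) = y ^ p * det (y \<cdot>\<^sub>m 1\<^sub>m q - B * A)"
proof -
  let ?M = "four_block_mat (y \<cdot>\<^sub>m 1\<^sub>m p) A B (1\<^sub>m q)"
  have "det ?M = det (y \<cdot>\<^sub>m 1\<^sub>m p - A * B)"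
    using det_four_block_scalar_lower_right[OF _ A B, of "y \<cdot>\<^sub>m 1\<^sub>m p" 1]
    by simp
  moreover have "det ?M * y ^ q = y ^ p * det (y \<cdot>\<^sub>m 1\<^sub>m q - B * A)"
    by (rule det_four_block_scalar_upper_left[OF _ A B]) auto
  ultimately show ?thesis by (simp add: mult.commute)
qed

lemma char_poly_mult_commute:
  fixes A B :: "'a :: field_char_0 mat"
  assumes A: "A \<in> carrier_mat p q" and B: "B \<in> carrier_mat q p" and pq: "p \<le> q"
  shows "char_poly (B * A) = monom 1 (q - p) * char_poly (A * B)"
proof -
  have AB: "A * B \<in> carrier_mat p p" and BA: "B * A \<in> carrier_mat q q"
    using A B by auto
  \<comment> \<open>Polynomials over a field of characteristic 0 are determined by their values; the
    common power of the variable is cancelled afterwards.\<close>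
  have "monom 1 p * char_poly (B * A) = monom 1 q * char_poly (A * B)"
    unfolding poly_eq_poly_eq_iff[symmetric] fun_eq_iff
    by (simp add: poly_monom poly_char_poly[OF AB] poly_char_poly[OF BA]
        det_scalar_minus_mult_commute[OF A B])
  also have "monom 1 q = (monom 1 p * monom 1 (q - p) :: 'a poly)"
    using pq by (simp add: mult_monom)
  finally show ?thesis by (simp add: mult.assoc)
qed

section \<open>Matrices given by kernels\<close>

text \<open>Indexing entries by elements instead of positions turns matrix products into sums over
  sets, so that matrix identities become counting statements.\<close>

definition kernel_mat :: "'a list \<Rightarrow> 'b list \<Rightarrow> ('a \<Rightarrow> 'b \<Rightarrow> 'c) \<Rightarrow> 'c mat" where
  "kernel_mat xs ys f = mat (length xs) (length ys) (\<lambda>(i, j). f (xs ! i) (ys ! j))"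

lemma kernel_mat_carrier [simp]:
  "kernel_mat xs ys f \<in> carrier_mat (length xs) (length ys)"
  by (simp add: kernel_mat_def)

lemma kernel_mat_dim [simp]:
  "dim_row (kernel_mat xs ys f) = length xs" "dim_col (kernel_mat xs ys f) = length ys"
  by (simp_all add: kernel_mat_def)

lemma kernel_mat_index [simp]:
  "i < length xs \<Longrightarrow> j < length ys \<Longrightarrow> kernel_mat xs ys f $$ (i, j) = f (xs ! i) (ys ! j)"
  by (simp add: kernel_mat_def)

lemma kernel_mat_cong:
  assumes "\<And>a b. a \<in> set xs \<Longrightarrow> b \<in> set ys \<Longrightarrow> f a b = g a b"
  shows "kernel_mat xs ys f = kernel_mat xs ys g"
  by (rule eq_matI) (use assms in auto)

lemma sum_nth_distinct:
  assumes "distinct xs"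
  shows "(\<Sum>i = 0..<length xs. h (xs ! i)) = sum h (set xs)"
  using assms
  by (simp add: sum_list_distinct_conv_sum_set[symmetric] sum_list_sum_nth)

lemma kernel_mat_mult:
  assumes "distinct ys"
  shows "kernel_mat xs ys f * kernel_mat ys zs g =
    kernel_mat xs zs (\<lambda>a c. \<Sum>b\<in>set ys. f a b * g b c)"
  by (rule eq_matI)
    (use sum_nth_distinct[OF assms, of "\<lambda>b. f _ b * g b _"] in \<open>auto simp: scalar_prod_def\<close>)

lemma kernel_mat_append:
  "kernel_mat (xs @ ys) (us @ vs) f =
    four_block_mat (kernel_mat xs us f) (kernel_mat xs vs f) (kernel_mat ys us f) (kernel_mat ys vs f)"
  by (rule eq_matI) (auto simp: nth_append)

lemma scalar_minus_kernel_mat: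
  fixes f :: "'a \<Rightarrow> 'a \<Rightarrow> 'c :: ring_1"
  assumes "distinct xs"
  shows "y \<cdot>\<^sub>m 1\<^sub>m (length xs) - kernel_mat xs xs f =
    kernel_mat xs xs (\<lambda>a b. (if a = b then y else 0) - f a b)"
  by (rule eq_matI) (use assms in \<open>auto simp: nth_eq_iff_index_eq\<close>)

lemma poly_char_poly_kernel_mat:
  fixes f :: "'a \<Rightarrow> 'a \<Rightarrow> 'c :: field"
  assumes "distinct xs"
  shows "poly (char_poly (kernel_mat xs xs f)) y =
    det (kernel_mat xs xs (\<lambda>a b. (if a = b then y else 0) - f a b))"
  by (simp add: poly_char_poly[OF kernel_mat_carrier] scalar_minus_kernel_mat[OF assms])

lemma poly_char_poly_kernel_mat_shift:
  fixes f :: "'a \<Rightarrow> 'a \<Rightarrow> 'c :: field"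
  assumes "distinct xs"
  shows "poly (char_poly (kernel_mat xs xs (\<lambda>a b. f a b + (if a = b then c else 0)))) y =
    poly (char_poly (kernel_mat xs xs f)) (y - c)"
  unfolding poly_char_poly_kernel_mat[OF assms]
  by (rule arg_cong[where f = det], rule kernel_mat_cong) auto

text \<open>Sylvester's identity in the form used twice below: for inclusion between consecutive
  layers and for incidence between vertices and edges.\<close>

lemma char_poly_kernel_mat_commute:
  fixes f :: "'a \<Rightarrow> 'b \<Rightarrow> 'c :: field_char_0"
  assumes "distinct xs" "distinct ys" "length xs \<le> length ys"
  shows "char_poly (kernel_mat ys ys (\<lambda>c d. \<Sum>a\<in>set xs. g c a * f a d)) =
    monom 1 (length ys - length xs) *
      char_poly (kernel_mat xs xs (\<lambda>a b. \<Sum>c\<in>set ys. f a c * g c b))"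
  using char_poly_mult_commute[OF kernel_mat_carrier[of xs ys f] kernel_mat_carrier[of ys xs g]] assms
  by (simp add: kernel_mat_mult)

section \<open>Inclusion between consecutive layers\<close>

definition layer :: "nat \<Rightarrow> nat \<Rightarrow> nat set set" where
  "layer n i = {U. U \<subseteq> {1..n} \<and> card U = i}"

lemma finite_layer [simp]: "finite (layer n i)"
  by (simp add: layer_def)

lemma card_layer [simp]: "card (layer n i) = n choose i"
  using n_subsets[of "{1..n}" i] by (simp add: layer_def)

lemma layerD:
  assumes "U \<in> layer n i"
  shows "finite U" "U \<subseteq> {1..n}" "card U = i"
  using assms by (auto simp: layer_def intro: finite_subset)

lemma card_upper_covers:
  assumes "U \<in> layer n i"
  shows "card {W \<in> layer n (Suc i). U \<subseteq> W} = n - i"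
proof -
  note U = layerD[OF assms]
  have "{W \<in> layer n (Suc i). U \<subseteq> W} = (\<lambda>x. insert x U) ` ({1..n} - U)"
  proof (intro equalityI subsetI)
    fix W assume "W \<in> {W \<in> layer n (Suc i). U \<subseteq> W}"
    then have W: "W \<subseteq> {1..n}" "finite W" "card W = Suc i" "U \<subseteq> W"
      using layerD[of W n "Suc i"] by simp_all
    then have "card (W - U) = 1"
      using U by (simp add: card_Diff_subset)
    then obtain x where "W - U = {x}"
      by (auto simp: card_1_singleton_iff)
    then have "W = insert x U" "x \<in> {1..n} - U"
      using W by auto
    then show "W \<in> (\<lambda>x. insert x U) ` ({1..n} - U)" by blast
  qed (use U in \<open>auto simp: layer_def\<close>)
  moreover have "inj_on (\<lambda>x. insert x U) ({1..n} - U)"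
    by (auto simp: inj_on_def)
  ultimately show ?thesis
    using U by (simp add: card_image card_Diff_subset)
qed

lemma card_lower_covers:
  assumes "W \<in> layer n (Suc i)"
  shows "card {U \<in> layer n i. U \<subseteq> W} = Suc i"
proof -
  note W = layerD[OF assms]
  have "{U \<in> layer n i. U \<subseteq> W} = {U. U \<subseteq> W \<and> card U = i}"
    using W by (auto simp: layer_def)
  then show ?thesis
    using n_subsets[OF W(1), of i] W by simp
qed

text \<open>The only possible common upper cover is the union of U and V, and the only possible
  common lower cover is their intersection. Each has the right size exactly when the intersection
  has i elements.\<close>

lemma card_common_covers:
  assumes "U \<in> layer n (Suc i)" "V \<in> layer n (Suc i)" "U \<noteq> V"
  shows "card {W \<in> layer n (Suc (Suc i)). U \<subseteq> W \<and> V \<subseteq> W} =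
    card {T \<in> layer n i. T \<subseteq> U \<and> T \<subseteq> V}"
proof -
  note U = layerD[OF assms(1)] and V = layerD[OF assms(2)]
  have sum: "card (U \<union> V) + card (U \<inter> V) = Suc (Suc (i + i))"
    using card_Un_Int[OF U(1) V(1)] U V by simp
  \<comment> \<open>Distinct sets of equal size meet in a proper subset of each. So the intersection
    has at most i elements and, by \<open>sum\<close>, the union at least i + 2.\<close>
  have ne: "card (U \<inter> V) \<noteq> Suc i"
    using card_subset_eq[of U "U \<inter> V"] card_subset_eq[of V "U \<inter> V"] U V assms(3) by auto
  have up: "{W \<in> layer n (Suc (Suc i)). U \<subseteq> W \<and> V \<subseteq> W} =
      (if card (U \<inter> V) = i then {U \<union> V} else {})"
  proof -
    have "W = U \<union> V" if "W \<in> layer n (Suc (Suc i))" "U \<subseteq> W" "V \<subseteq> W" for W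
    proof -
      note W = layerD[OF that(1)]
      have "card (U \<inter> V) \<le> i"
        using card_mono[of U "U \<inter> V"] U ne by auto
      then have "card W \<le> card (U \<union> V)"
        using sum W by simp
      with W that show ?thesis by (metis Un_least card_seteq)
    qed
    then show ?thesis
      using sum U V by (auto simp: layer_def)
  qed
  have down: "{T \<in> layer n i. T \<subseteq> U \<and> T \<subseteq> V} = (if card (U \<inter> V) = i then {U \<inter> V} else {})"
  proof -
    have "T = U \<inter> V" if "T \<in> layer n i" "T \<subseteq> U" "T \<subseteq> V" for T
    proof -
      have "card (U \<inter> V) \<le> i"
        using card_mono[of U "U \<inter> V"] U ne by auto
      then have "card (U \<inter> V) \<le> card T"
        using layerD[OF that(1)] by simp
      with U that show ?thesis by (metis Int_greatest card_seteq finite_Int)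
    qed
    then show ?thesis
      using U V by (auto simp: layer_def)
  qed
  show ?thesis unfolding up down by simp
qed

definition incl :: "nat set \<Rightarrow> nat set \<Rightarrow> complex" where
  "incl U W = of_bool (U \<subseteq> W)"

lemma sum_incl_mult:
  "finite S \<Longrightarrow> (\<Sum>W\<in>S. incl U W * incl V W) = of_nat (card {W \<in> S. U \<subseteq> W \<and> V \<subseteq> W})"
  "finite S \<Longrightarrow> (\<Sum>T\<in>S. incl T U * incl T V) = of_nat (card {T \<in> S. T \<subseteq> U \<and> T \<subseteq> V})"
  by (simp_all add: incl_def of_bool_conj[symmetric] sum_of_bool_eq Int_def)

text \<open>Entrywise form of the commutation relation between W_i and W_(i+1). On the diagonal, n -
  (i+1) upper covers stand against i+1 lower covers; off the diagonal the common covers above and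
  below are equinumerous.\<close>

lemma up_down_commutation:
  assumes "U \<in> layer n (Suc i)" "V \<in> layer n (Suc i)"
  shows "(\<Sum>W\<in>layer n (Suc (Suc i)). incl U W * incl V W) =
    (\<Sum>T\<in>layer n i. incl T U * incl T V) + (if U = V then of_nat n - 2 * of_nat (Suc i) else 0)"
proof (cases "U = V")
  case True
  have "Suc i \<le> n"
    using layerD[OF assms(1)] card_mono[of "{1..n}" U] by simp
  then show ?thesis
    using True card_upper_covers[OF assms(1)] card_lower_covers[OF assms(1)]
    by (simp add: sum_incl_mult of_nat_diff)
next
  case False
  then show ?thesis
    using card_common_covers[OF assms] by (simp add: sum_incl_mult)
qed

lemma binom_diff_Suc: "binom n (int (Suc i)) - binom n (int (Suc i) - 1) = (n choose Suc i) - (n choose i)"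
  by (simp add: binom_def nat_add_distrib)

text \<open>Passing from i to i+1, Sylvester's identity adds zero eigenvalues and the commutation
  relation then shifts all eigenvalues by n - 2(i+1). Since 2i does not exceed n, the layers grow in
  size, so the exponents are true differences.\<close>

lemma poly_char_poly_up_down:
  assumes "distinct us" "set us = layer n i" "2 * i \<le> n"
  shows "poly (char_poly (kernel_mat us us (\<lambda>U V. \<Sum>W\<in>layer n (Suc i). incl U W * incl V W))) y =
    (\<Prod>j = 0..i. (y - (of_nat (Suc i) - of_nat j) * (of_nat n - of_nat i - of_nat j))
       ^ (binom n (int j) - binom n (int j - 1)))"
  using assms
proof (induction i arbitrary: us y)
  case 0
  have "layer n 0 = {{}}"
    by (auto simp: layer_def dest: finite_subset)
  with 0 have us: "us = [{}]"
    by (cases us) (auto simp: set_empty2 subset_singleton_iff)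
  \<comment> \<open>The matrix is 1 by 1 with entry n, and the exponent for j = 0 is 1 because
    \<open>binom n (- 1)\<close> is 0.\<close>
  have "card {W \<in> layer n (Suc 0). {} \<subseteq> W} = n"
    using card_upper_covers[of "{}" n 0] by (simp add: layer_def)
  then show ?case
    using us by (simp add: poly_char_poly_kernel_mat sum_incl_mult binom_def det_single carrier_matI)
next
  case (Suc i)
  obtain ts where ts: "distinct ts" "set ts = layer n i"
    using finite_distinct_list[OF finite_layer] by blast
  define z where "z = y - (of_nat n - 2 * of_nat (Suc i))"
  have len: "length us = n choose Suc i" "length ts = n choose i"
    using ts Suc.prems distinct_card by (metis card_layer)+
  then have "length ts \<le> length us"
    using Suc.prems by (simp add: binomial_mono)
  note commute = char_poly_kernel_mat_commute[OF ts(1) Suc.prems(1) this, of "\<lambda>U T. incl T U" incl]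
  have "kernel_mat us us (\<lambda>U V. \<Sum>W\<in>layer n (Suc (Suc i)). incl U W * incl V W) =
      kernel_mat us us (\<lambda>U V. (\<Sum>T\<in>layer n i. incl T U * incl T V) +
        (if U = V then of_nat n - 2 * of_nat (Suc i) else 0))"
    by (rule kernel_mat_cong) (use Suc.prems in \<open>simp add: up_down_commutation del: of_nat_Suc\<close>)
  then have "poly (char_poly (kernel_mat us us
      (\<lambda>U V. \<Sum>W\<in>layer n (Suc (Suc i)). incl U W * incl V W))) y =
      poly (char_poly (kernel_mat us us (\<lambda>U V. \<Sum>T\<in>layer n i. incl T U * incl T V))) z"
    by (simp add: poly_char_poly_kernel_mat_shift[OF Suc.prems(1)] z_def)
  also have "\<dots> = z ^ ((n choose Suc i) - (n choose i)) * poly (char_poly (kernel_mat ts ts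
      (\<lambda>U V. \<Sum>W\<in>layer n (Suc i). incl U W * incl V W))) z"
    using commute Suc.prems ts len by (simp add: poly_monom)
  also have "\<dots> = z ^ ((n choose Suc i) - (n choose i)) *
      (\<Prod>j = 0..i. (z - (of_nat (Suc i) - of_nat j) * (of_nat n - of_nat i - of_nat j))
       ^ (binom n (int j) - binom n (int j - 1)))"
    using Suc.IH[OF ts] Suc.prems by simp
  \<comment> \<open>With a = i+1-j and b = n-i-j the shift is b - a - 1, and ab + b - a - 1 =
    (a+1)(b-1).\<close>
  also have "(\<lambda>j. z - (of_nat (Suc i) - of_nat j) * (of_nat n - of_nat i - of_nat j)) =
      (\<lambda>j. y - (of_nat (Suc (Suc i)) - of_nat j) * (of_nat n - of_nat (Suc i) - of_nat j))"
    by (rule ext) (simp add: z_def algebra_simps)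
  \<comment> \<open>The shifted zero eigenvalue fits the same formula and supplies the new factor j
    = i+1.\<close>
  also have "z = y - (of_nat (Suc (Suc i)) - of_nat (Suc i)) * (of_nat n - of_nat (Suc i) - of_nat (Suc i))"
    by (simp add: z_def algebra_simps)
  finally show ?case
    by (simp only: prod.atLeast0_atMost_Suc binom_diff_Suc mult.commute)
qed

section \<open>Line graphs and the signless Laplacian\<close>

text \<open>Distinct 2-sets meet in at most one point, so the size of their intersection is their
  adjacency in the line graph. On the diagonal the size is 2, while \<open>{e, e}\<close> is a
  singleton and hence not an edge.\<close>

lemma adjacency_line_graph_entry:
  assumes "card e = 2" "card f = 2" "e \<in> edges G" "f \<in> edges G"
  shows "of_nat (card (e \<inter> f)) =
    (if {e, f} \<in> edges (line_graph G) then 1 else 0) + (if e = f then 2 else (0 :: complex))"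
proof (cases "e = f")
  case True
  then have "{e, f} \<notin> edges (line_graph G)"
    by (auto simp: line_graph_def doubleton_eq_iff)
  with True assms show ?thesis by simp
next
  case False
  have fin: "finite e" "finite f"
    using assms by (auto intro: card_ge_0_finite)
  have "card (e \<inter> f) \<noteq> 2"
    using card_subset_eq[OF fin(1), of "e \<inter> f"] card_subset_eq[OF fin(2), of "e \<inter> f"] assms False by auto
  moreover have "card (e \<inter> f) \<le> 2"
    using card_mono[OF fin(1), of "e \<inter> f"] assms by simp
  moreover have "{e, f} \<in> edges (line_graph G) \<longleftrightarrow> card (e \<inter> f) \<noteq> 0"
    using False assms fin by (auto simp: line_graph_def)
  ultimately show ?thesis
    using False by (auto simp: le_Suc_eq numeral_2_eq_2)
qed

text \<open>Counting the edges through u and v gives degrees on the diagonal and adjacencies off it,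
  so the kernel on the right is the signless Laplacian. The surplus of edges over vertices
  contributes eigenvalues -2.\<close>

lemma poly_char_poly_line_graph:
  assumes "finite (verts G)" and simple: "\<forall>e\<in>edges G. e \<subseteq> verts G \<and> card e = 2"
    and es: "vertex_enum (line_graph G) es" and vs: "vertex_enum G vs"
    and "length vs \<le> length es"
  shows "poly (char_poly (adjacency_matrix (line_graph G) es)) x =
    (x + 2) ^ (length es - length vs) *
    poly (char_poly (kernel_mat vs vs (\<lambda>u v. of_nat (card {e \<in> edges G. u \<in> e \<and> v \<in> e})))) (x + 2)"
proof -
  let ?inc = "\<lambda>v e. of_bool (v \<in> e) :: complex"
  let ?L = "\<lambda>e f. if {e, f} \<in> edges (line_graph G) then 1 else 0 :: complex"
  have dist: "distinct es" "distinct vs" "set es = edges G" "set vs = verts G"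
    using es vs by (auto simp: vertex_enum_def line_graph_def)
  have "finite (edges G)"
    using dist(3) by (metis List.finite_set)
  then have VV: "(\<Sum>e\<in>set es. ?inc u e * ?inc v e) = of_nat (card {e \<in> edges G. u \<in> e \<and> v \<in> e})"
    for u v
    by (simp add: of_bool_conj[symmetric] sum_of_bool_eq Int_def dist)
  have EE: "(\<Sum>v\<in>set vs. ?inc v e * ?inc v f) = ?L e f + (if e = f then 2 else 0)"
    if "e \<in> edges G" "f \<in> edges G" for e f
  proof -
    have "{v \<in> verts G. v \<in> e \<and> v \<in> f} = e \<inter> f"
      using simple that by auto
    then have "(\<Sum>v\<in>set vs. ?inc v e * ?inc v f) = of_nat (card (e \<inter> f))"
      using assms(1) by (simp add: of_bool_conj[symmetric] sum_of_bool_eq dist Int_def)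
    with that simple show ?thesis
      by (metis adjacency_line_graph_entry)
  qed
  have "poly (char_poly (kernel_mat es es (\<lambda>e f. \<Sum>v\<in>set vs. ?inc v e * ?inc v f))) (x + 2) =
    poly (char_poly (kernel_mat es es (\<lambda>e f. ?L e f + (if e = f then 2 else 0)))) (x + 2)"
    by (intro arg_cong[where f = "\<lambda>M. poly (char_poly M) _"] kernel_mat_cong EE) (auto simp: dist)
  also have "\<dots> = poly (char_poly (kernel_mat es es ?L)) x"
    by (simp add: poly_char_poly_kernel_mat_shift dist)
  also have "kernel_mat es es ?L = adjacency_matrix (line_graph G) es"
    by (simp add: kernel_mat_def adjacency_matrix_def)
  finally show ?thesis
    using char_poly_kernel_mat_commute[OF dist(2,1) assms(5), of "\<lambda>e v. ?inc v e" ?inc]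
    by (simp add: poly_monom VV)
qed

section \<open>The graph BL_n(k-1,k): edges, degrees and common edges, with k = i+1\<close>

lemma verts_BL_layers:
  "verts (BL_layers n (Suc i)) = layer n i \<union> layer n (Suc i)"
  by (auto simp: BL_layers_def induced_subgraph_def BL_def layer_def)

lemma edges_BL_layers:
  "edges (BL_layers n (Suc i)) = {{U, W} | U W. U \<in> layer n i \<and> W \<in> layer n (Suc i) \<and> U \<subseteq> W}"
proof -
  \<comment> \<open>The two one-sided differences have total size 1; if U is not the larger set, the
    single element must lie in W.\<close>
  have cover: "U \<subseteq> W \<and> card W = Suc (card U)"
    if "card (sym_diff U W) = 1" "card U \<le> card W" "finite U" "finite W" for U W :: "nat set"
  proof -
    have "card (U - W) + card (W - U) = 1"
      using that by (subst card_Un_disjoint[symmetric]) auto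
    moreover have "card U = card (U \<inter> W) + card (U - W)" "card W = card (U \<inter> W) + card (W - U)"
      using that card_Int_Diff[of U W] card_Int_Diff[of W U] by (auto simp: Int_commute)
    ultimately have "card (U - W) = 0 \<and> card W = Suc (card U)"
      using that(2) by presburger
    then show ?thesis using that by auto
  qed
  show ?thesis
  proof (intro equalityI subsetI)
    fix e assume "e \<in> edges (BL_layers n (Suc i))"
    then obtain U W where e: "e = {U, W}" and UW: "U \<subseteq> {1..n}" "W \<subseteq> {1..n}" "card (sym_diff U W) = 1"
      "card U = i \<or> card U = Suc i" "card W = i \<or> card W = Suc i"
      by (auto simp: BL_layers_def induced_subgraph_def BL_def)
    have fin: "finite U" "finite W"
      using UW by (auto intro: finite_subset)
    show "e \<in> {{U, W} | U W. U \<in> layer n i \<and> W \<in> layer n (Suc i) \<and> U \<subseteq> W}"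
    proof (cases "card U \<le> card W")
      case True
      with cover[OF UW(3) _ fin] UW show ?thesis
        unfolding e by (auto simp: layer_def)
    next
      case False
      moreover have "card (sym_diff W U) = 1"
        using UW by (simp add: Un_commute)
      ultimately show ?thesis
        using cover[of W U] fin UW unfolding e by (auto simp: layer_def insert_commute)
    qed
  next
    fix e assume "e \<in> {{U, W} | U W. U \<in> layer n i \<and> W \<in> layer n (Suc i) \<and> U \<subseteq> W}"
    then obtain U W where e: "e = {U, W}" and UW: "U \<in> layer n i" "W \<in> layer n (Suc i)" "U \<subseteq> W"
      by auto
    note U = layerD[OF UW(1)] and W = layerD[OF UW(2)]
    have "U - W = {}" using UW by auto
    moreover have "card (W - U) = 1"
      using U W UW by (simp add: card_Diff_subset)
    ultimately have "card (sym_diff U W) = 1" by (simp only: Un_empty_left)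
    then show "e \<in> edges (BL_layers n (Suc i))"
      using U W unfolding e by (auto simp: BL_layers_def induced_subgraph_def BL_def)
  qed
qed

lemma layer_disjoint: "U \<in> layer n i \<Longrightarrow> W \<in> layer n (Suc i) \<Longrightarrow> U \<noteq> W"
  by (auto simp: layer_def)

text \<open>Edges are counted by their upper endpoint. Disjointness of the layers makes the
  endpoints of an edge distinguishable, hence the counting map injective.\<close>

lemma card_edges_BL_layers: "card (edges (BL_layers n (Suc i))) = Suc i * (n choose Suc i)"
proof -
  let ?S = "SIGMA W : layer n (Suc i). {U \<in> layer n i. U \<subseteq> W}"
  have "edges (BL_layers n (Suc i)) = (\<lambda>(W, U). {U, W}) ` ?S"
    by (auto simp: edges_BL_layers)
  moreover have "inj_on (\<lambda>(W, U). {U, W}) ?S"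
    by (auto simp: inj_on_def doubleton_eq_iff dest: layer_disjoint)
  ultimately have "card (edges (BL_layers n (Suc i))) = card ?S"
    by (simp add: card_image)
  also have "\<dots> = (\<Sum>W\<in>layer n (Suc i). card {U \<in> layer n i. U \<subseteq> W})"
    by (simp add: card_SigmaI)
  finally show ?thesis
    by (simp add: card_lower_covers)
qed

text \<open>These are the blocks of the signless Laplacian. Every edge has one endpoint in each
  layer, which makes the diagonal blocks scalar.\<close>

lemma card_common_edges_BL_layers:
  assumes "U \<in> layer n i" "U' \<in> layer n i" "W \<in> layer n (Suc i)" "W' \<in> layer n (Suc i)"
  defines "E \<equiv> edges (BL_layers n (Suc i))"
  shows "card {e \<in> E. U \<in> e \<and> U' \<in> e} = (if U = U' then n - i else 0)"
    and "card {e \<in> E. W \<in> e \<and> W' \<in> e} = (if W = W' then Suc i else 0)"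
    and "card {e \<in> E. U \<in> e \<and> W \<in> e} = (if U \<subseteq> W then 1 else 0)"
proof -
  note dj = layer_disjoint[of _ n i]
  show "card {e \<in> E. U \<in> e \<and> U' \<in> e} = (if U = U' then n - i else 0)"
  proof (cases "U = U'")
    case True
    have "{e \<in> E. U \<in> e \<and> U' \<in> e} = (\<lambda>W. {U, W}) ` {W \<in> layer n (Suc i). U \<subseteq> W}"
      using assms(1-4) dj by (auto simp: True E_def edges_BL_layers)
    moreover have "inj_on (\<lambda>W. {U, W}) {W \<in> layer n (Suc i). U \<subseteq> W}"
      by (auto simp: inj_on_def doubleton_eq_iff)
    ultimately show ?thesis
      using True assms(1) by (simp add: card_image card_upper_covers)
  next
    case False
    then have "{e \<in> E. U \<in> e \<and> U' \<in> e} = {}"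
      using assms(1-4) dj by (auto simp: E_def edges_BL_layers)
    with False show ?thesis by (simp only: card.empty if_False)
  qed
  show "card {e \<in> E. W \<in> e \<and> W' \<in> e} = (if W = W' then Suc i else 0)"
  proof (cases "W = W'")
    case True
    have "{e \<in> E. W \<in> e \<and> W' \<in> e} = (\<lambda>U. {U, W}) ` {U \<in> layer n i. U \<subseteq> W}"
      using assms(1-4) dj by (auto simp: True E_def edges_BL_layers)
    moreover have "inj_on (\<lambda>U. {U, W}) {U \<in> layer n i. U \<subseteq> W}"
      by (auto simp: inj_on_def doubleton_eq_iff)
    ultimately show ?thesis
      using True assms(3) by (simp add: card_image card_lower_covers)
  next
    case False
    then have "{e \<in> E. W \<in> e \<and> W' \<in> e} = {}"
      using assms(1-4) dj by (auto simp: E_def edges_BL_layers)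
    with False show ?thesis by (simp only: card.empty if_False)
  qed
  have "{e \<in> E. U \<in> e \<and> W \<in> e} = (if U \<subseteq> W then {{U, W}} else {})"
    using assms(1-4) dj by (auto simp: E_def edges_BL_layers)
  then show "card {e \<in> E. U \<in> e \<and> W \<in> e} = (if U \<subseteq> W then 1 else 0)" by simp
qed

text \<open>The Schur complement at the lower right block d I yields the identity multiplied by d^p,
  where d = y - (i+1). The assumption on y allows d^p to be cancelled; the excluded point is
  recovered later by \<open>poly_eqI_cofinite\<close>.\<close>

lemma poly_char_poly_signless_Laplacian_BL_layers:
  fixes y :: complex
  assumes us: "distinct us" "set us = layer n i" and ws: "distinct ws" "set ws = layer n (Suc i)"
    and n: "2 * Suc i \<le> n" and y: "y \<noteq> of_nat (Suc i)"
  shows "poly (char_poly (kernel_mat (us @ ws) (us @ ws)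
      (\<lambda>u v. of_nat (card {e \<in> edges (BL_layers n (Suc i)). u \<in> e \<and> v \<in> e})))) y =
    (y - of_nat (Suc i)) ^ ((n choose Suc i) - (n choose i)) *
    (\<Prod>j = 0..i. ((y - of_nat j) * (y - (of_nat n + 1 - of_nat j)))
       ^ (binom n (int j) - binom n (int j - 1)))"
proof -
  define E where "E = edges (BL_layers n (Suc i))"
  define Q where "Q = (\<lambda>u v. of_nat (card {e \<in> E. u \<in> e \<and> v \<in> e}) :: complex)"
  define p q where "p = length us" and "q = length ws"
  \<comment> \<open>The diagonal scalars of yI - Q: lower sets have degree n - i, upper sets i +
    1.\<close>
  define a d where "a = y - of_nat (n - i)" and "d = y - of_nat (Suc i)"
  let ?B = "kernel_mat us ws (\<lambda>U W. - incl U W)" and ?C = "kernel_mat ws us (\<lambda>W U. - incl U W)"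
  have dist: "distinct (us @ ws)"
    using us ws layer_disjoint[of _ n i] by auto
  have pq: "p = n choose i" "q = n choose Suc i"
    using us ws distinct_card unfolding p_def q_def by (metis card_layer)+
  have "p \<le> q"
    unfolding pq using n by (intro binomial_mono) auto
  have Q: "Q U U' = (if U = U' then of_nat (n - i) else 0)" "Q W W' = (if W = W' then of_nat (Suc i) else 0)"
    "Q U W = incl U W" "Q W U = incl U W"
    if "U \<in> layer n i" "U' \<in> layer n i" "W \<in> layer n (Suc i)" "W' \<in> layer n (Suc i)" for U U' W W'
  proof -
    show "Q U U' = (if U = U' then of_nat (n - i) else 0)" "Q W W' = (if W = W' then of_nat (Suc i) else 0)"
      and UW: "Q U W = incl U W"
      using card_common_edges_BL_layers[OF that] by (simp_all add: Q_def E_def incl_def)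
    have "Q W U = Q U W"
      by (simp add: Q_def conj_commute)
    with UW show "Q W U = incl U W" by simp
  qed
  \<comment> \<open>The facts \<open>Q\<close> speak of four sets at once; the witnesses fill the
    places that a given block does not mention.\<close>
  have U0: "\<exists>U. U \<in> layer n i" and W0: "\<exists>W. W \<in> layer n (Suc i)"
    using n card_layer[of n i] card_layer[of n "Suc i"] by (metis all_not_in_conv binomial_eq_0_iff
      card.empty not_le Suc_leD le_trans mult_2 le_add1)+
  then obtain U0 W0 where 0: "U0 \<in> layer n i" "W0 \<in> layer n (Suc i)" by blast
  have blocks: "kernel_mat (us @ ws) (us @ ws) (\<lambda>u v. (if u = v then y else 0) - Q u v) =
      four_block_mat (a \<cdot>\<^sub>m 1\<^sub>m p) ?B ?C (d \<cdot>\<^sub>m 1\<^sub>m q)"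
  proof -
    have "kernel_mat us us (\<lambda>u v. (if u = v then y else 0) - Q u v) = a \<cdot>\<^sub>m 1\<^sub>m p"
      by (rule eq_matI) (use us Q(1)[OF _ _ 0(2,2)] nth_mem[of _ us] in
          \<open>auto simp: p_def a_def nth_eq_iff_index_eq\<close>)
    moreover have "kernel_mat ws ws (\<lambda>u v. (if u = v then y else 0) - Q u v) = d \<cdot>\<^sub>m 1\<^sub>m q"
      by (rule eq_matI) (use ws Q(2)[OF 0(1,1)] nth_mem[of _ ws] in
          \<open>auto simp: q_def d_def nth_eq_iff_index_eq\<close>)
    moreover have "kernel_mat us ws (\<lambda>u v. (if u = v then y else 0) - Q u v) = ?B"
      by (rule kernel_mat_cong) (use us ws Q(3)[OF _ 0(1) _ 0(2)] in \<open>auto dest: layer_disjoint\<close>)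
    moreover have "kernel_mat ws us (\<lambda>u v. (if u = v then y else 0) - Q u v) = ?C"
      by (rule kernel_mat_cong) (use us ws Q(4)[OF _ 0(1) _ 0(2)] in \<open>auto dest: layer_disjoint\<close>)
    ultimately show ?thesis by (simp add: kernel_mat_append)
  qed
  let ?N = "kernel_mat us us (\<lambda>U V. \<Sum>W\<in>layer n (Suc i). incl U W * incl V W)"
  have BC: "?B * ?C = ?N"
    using ws by (simp add: kernel_mat_mult)
  have "poly (char_poly (kernel_mat (us @ ws) (us @ ws) Q)) y * d ^ p =
      det (four_block_mat (a \<cdot>\<^sub>m 1\<^sub>m p) ?B ?C (d \<cdot>\<^sub>m 1\<^sub>m q)) * d ^ p"
    by (simp only: poly_char_poly_kernel_mat[OF dist] blocks)
  also have "\<dots> = det (d \<cdot>\<^sub>m (a \<cdot>\<^sub>m 1\<^sub>m p) - ?N) * d ^ q"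
    unfolding BC[symmetric] by (rule det_four_block_scalar_lower_right) (simp_all add: p_def q_def)
  also have "d \<cdot>\<^sub>m (a \<cdot>\<^sub>m 1\<^sub>m p) = (d * a) \<cdot>\<^sub>m 1\<^sub>m p"
    by (rule eq_matI) auto
  also have "det ((d * a) \<cdot>\<^sub>m 1\<^sub>m p - ?N) = poly (char_poly ?N) (d * a)"
    unfolding p_def by (rule poly_char_poly[symmetric]) simp
  also have "\<dots> = (\<Prod>j = 0..i. (d * a - (of_nat (Suc i) - of_nat j) * (of_nat n - of_nat i - of_nat j))
       ^ (binom n (int j) - binom n (int j - 1)))"
    using n by (intro poly_char_poly_up_down us) simp
  \<comment> \<open>As quadratics in y both sides have root sum n + 1, and both have constant term
    j(n+1-j).\<close>
  also have "(\<lambda>j. d * a - (of_nat (Suc i) - of_nat j) * (of_nat n - of_nat i - of_nat j)) =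
      (\<lambda>j. (y - of_nat j) * (y - (of_nat n + 1 - of_nat j)))"
    using n by (intro ext) (simp add: a_def d_def of_nat_diff algebra_simps)
  \<comment> \<open>The surplus of upper over lower sets becomes the multiplicity of the eigenvalue
    i + 1.\<close>
  also have "d ^ q = d ^ (q - p) * d ^ p"
    using \<open>p \<le> q\<close> by (simp flip: power_add)
  finally show ?thesis
    using y by (simp add: d_def Q_def E_def pq mult.commute)
qed

section \<open>Assembly of the spectrum\<close>

lemma poly_eqI_cofinite:
  fixes p q :: "'a :: {idom, ring_char_0} poly"
  assumes "finite S" "\<And>x. x \<notin> S \<Longrightarrow> poly p x = poly q x"
  shows "p = q"
proof (rule ccontr)
  assume "p \<noteq> q"
  then have "finite {x. poly (p - q) x = 0}"
    by (intro poly_roots_finite) simp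
  moreover have "UNIV \<subseteq> S \<union> {x. poly (p - q) x = 0}"
    using assms(2) by auto
  ultimately have "finite (UNIV :: 'a set)"
    using assms(1) by (metis finite_UnI finite_subset)
  then show False
    using infinite_UNIV_char_0 by blast
qed

theorem theorem3p2:
  fixes n k :: nat and es :: "nat set set list"
  assumes "k \<ge> 2" and "n \<ge> 2 * k"
    and "vertex_enum (line_graph (BL_layers n k)) es"
  shows "spectrum_mset (adjacency_matrix (line_graph (BL_layers n k)) es) =
      replicate_mset (k * (n choose k) - ((n + 1) choose k) + 1) (- 2)
    + (\<Sum>j = 1..k - 1. replicate_mset (binom n (int j) - binom n (int j - 1)) (of_nat j - 2))
    + (\<Sum>j = 0..k - 1. replicate_mset (binom n (int j) - binom n (int j - 1)) (of_nat n - 1 - of_nat j))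
    + replicate_mset ((n choose k) - (n choose (k - 1))) (of_nat k - 2)"
proof -
  obtain i where k: "k = Suc i" using assms(1) by (cases k) auto
  let ?G = "BL_layers n k"
  define m where "m j = binom n (int j) - binom n (int j - 1)" for j
  obtain us ws where us: "distinct us" "set us = layer n i" and ws: "distinct ws" "set ws = layer n k"
    using finite_distinct_list[OF finite_layer] by metis
  have vs: "vertex_enum ?G (us @ ws)"
    using us ws layer_disjoint[of _ n i] by (auto simp: vertex_enum_def verts_BL_layers k)
  \<comment> \<open>Pascal's rule adds the sizes of the two layers.\<close>
  have len_vs: "length (us @ ws) = (n + 1) choose k"
    using us ws distinct_card[of us] distinct_card[of ws] by (simp add: k)
  have len_es: "length es = k * (n choose k)"
    using assms(3) distinct_card[of es] card_edges_BL_layers[of n i]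
    by (simp add: vertex_enum_def line_graph_def k)
  have le: "length (us @ ws) \<le> length es"
    unfolding len_vs len_es using assms(1,2) by (rule choose_Suc_le_mult_choose)
  have simple: "\<forall>e\<in>edges ?G. e \<subseteq> verts ?G \<and> card e = 2"
    using layer_disjoint[of _ n i] by (auto simp: k edges_BL_layers verts_BL_layers card_insert_if)
  have fin: "finite (verts ?G)" by (simp add: k verts_BL_layers)
  \<comment> \<open>The expected characteristic polynomial, written in factors X - a so that its
    roots can be read off.\<close>
  define P where "P = [:- (- 2), 1:] ^ (k * (n choose k) - ((n + 1) choose k) + 1)
    * (\<Prod>j = 1..k - 1. [:- (of_nat j - 2), 1:] ^ m j)
    * (\<Prod>j = 0..k - 1. [:- (of_nat n - 1 - of_nat j), 1:] ^ m j)
    * [:- (of_nat k - 2), 1 :: complex:] ^ ((n choose k) - (n choose (k - 1)))"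
  have "char_poly (adjacency_matrix (line_graph ?G) es) = P"
  proof (rule poly_eqI_cofinite)
    fix x :: complex assume "x \<notin> {of_nat k - 2}"
    then have "x + 2 \<noteq> of_nat (Suc i)" by (auto simp: k algebra_simps)
    note Q = poly_char_poly_signless_Laplacian_BL_layers[OF us ws[unfolded k] assms(2)[unfolded k] this,
        folded k m_def]
    \<comment> \<open>The factor y - j with j = 0 is y = x + 2 itself, with exponent
      \<open>m 0\<close> equal to 1. It accounts for the + 1 in the multiplicity of -2, and for the
      family j - 2 starting at j = 1.\<close>
    have prod: "(\<Prod>j = 0..i. ((x + 2 - of_nat j) * (x + 2 - (of_nat n + 1 - of_nat j))) ^ m j) =
      (x + 2) * (\<Prod>j = 1..i. (x + 2 - of_nat j) ^ m j) *
      (\<Prod>j = 0..i. (x + 2 - (of_nat n + 1 - of_nat j)) ^ m j)"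
    proof -
      have "(\<Prod>j = 0..i. (x + 2 - of_nat j) ^ m j) = (x + 2) * (\<Prod>j = 1..i. (x + 2 - of_nat j) ^ m j)"
        by (simp add: prod.atLeast_Suc_atMost m_def binom_def)
      then show ?thesis
        by (simp add: power_mult_distrib prod.distrib)
    qed
    have "poly P x = (x + 2) ^ (k * (n choose k) - ((n + 1) choose k) + 1) *
      (\<Prod>j = 1..i. (x + 2 - of_nat j) ^ m j) *
      (\<Prod>j = 0..i. (x + 2 - (of_nat n + 1 - of_nat j)) ^ m j) *
      (x + 2 - of_nat k) ^ ((n choose k) - (n choose i))"
      unfolding P_def by (simp add: k poly_prod algebra_simps)
    then show "poly (char_poly (adjacency_matrix (line_graph ?G) es)) x = poly P x"
      unfolding poly_char_poly_line_graph[OF fin simple assms(3) vs le] len_vs len_es Q prod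
      by simp
  qed simp
  moreover have "proots P = replicate_mset (k * (n choose k) - ((n + 1) choose k) + 1) (- 2)
    + (\<Sum>j = 1..k - 1. replicate_mset (m j) (of_nat j - 2))
    + (\<Sum>j = 0..k - 1. replicate_mset (m j) (of_nat n - 1 - of_nat j))
    + replicate_mset ((n choose k) - (n choose (k - 1))) (of_nat k - 2)"
  proof -
    have linear: "proots ([:- a, 1:] ^ r) = replicate_mset r a" for a :: complex and r
      by (simp add: proots_power)
    \<comment> \<open>Root multisets add over a product only when its factors are nonzero.\<close>
    have nz: "[:- a, 1:] ^ r \<noteq> 0" for a :: complex and r by simp
    then have nz_prod: "(\<Prod>j\<in>S. [:- f j, 1:] ^ m j) \<noteq> 0" if "finite S"
      for f :: "nat \<Rightarrow> complex" and S
      using that by (simp add: prod_zero_iff)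
    have prods: "proots (\<Prod>j\<in>S. [:- f j, 1:] ^ m j) = (\<Sum>j\<in>S. replicate_mset (m j) (f j))"
      for f :: "nat \<Rightarrow> complex" and S
      by (subst proots_prod) (use nz linear in auto)
    show ?thesis
      unfolding P_def
      by (simp only: proots_mult mult_eq_0_iff nz nz_prod[OF finite_atLeastAtMost] linear prods
          de_Morgan_disj simp_thms)
  qed
  ultimately show ?thesis
    by (simp add: spectrum_mset_def m_def)
qed

end
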